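(* Let $f$ be a real entire function of genus $p$ with only real zeros $\{\lambda_k\}$ (counted with multiplicity). Let $u(x)=\log|f(i\sqrt x)|$ for $x>0$, and let $m=\lfloor p/2\rfloor$ be the integer part of $p/2$. Then $(-1)^m\partial_x^{m+1}u(x)$ is a generalised Stieltjes function of order $m+1$ with the representation $$(-1)^m\partial_x^{m+1}u(x)=\frac{m!}{2}\int_0^\infty\frac{d\mu(t)}{(t+x)^{m+1}},\qquad x>0,$$ where $\mu=\sum_{k\ge1}\epsilon_{\lambda_k^2}$.
   Context: A real entire function is an entire function (not identically zero) that is real on the real axis. $\epsilon_c$ denotes the unit point mass at $c$; sums over $k$ run over all zeros. $\partial_x$ is differentiation with respect to $x$. A function $F$ on $(0,\infty)$ is a generalised Stieltjes function of order $\lambda>0$ if $F(x)=\int_0^\infty \frac{d\mu(t)}{(t+x)^\lambda}+c$ for all $x>0$, for some positive (i.e. non-negative) measure $\mu$ on $[0,\infty)$ making the integral converge and some $c\ge 0$. *)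

theory Defs
  imports "HOL-Complex_Analysis.Complex_Analysis"
begin

definition real_entire :: "(complex \<Rightarrow> complex) \<Rightarrow> bool" where
  "real_entire f \<longleftrightarrow>
     f holomorphic_on UNIV \<and> (\<exists>z. f z \<noteq> 0) \<and> (\<forall>x::real. f (of_real x) \<in> \<real>)"

(* The family (a k), k in K, lists all the zeros of f, each repeated according to its
   multiplicity.  K is an arbitrary subset of nat, so that no zeros, finitely many and
   infinitely many zeros are all covered.  Finiteness is required separately because card is 0
   for infinite sets. *)
definition enumerates_zeros ::
  "(complex \<Rightarrow> complex) \<Rightarrow> nat set \<Rightarrow> (nat \<Rightarrow> complex) \<Rightarrow> bool" where
  "enumerates_zeros f K a \<longleftrightarrow>
     (\<forall>z. finite {k\<in>K. a k = z} \<and>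
          int (card {k\<in>K. a k = z}) = (if f z = 0 then zorder f z else 0))"

(* Hadamard's representation f(z) = z^n exp(Q(z)) prod E_q(z / a_k), the product running over
   the nonzero zeros, with q the least natural number for which the sum of 1 / |a_k|^(q+1)
   converges; the genus is max (degree Q) q.  This is a relation, since an entire
   function need not have finite genus. *)
definition has_genus :: "(complex \<Rightarrow> complex) \<Rightarrow> nat \<Rightarrow> bool" where
  "has_genus f p \<longleftrightarrow>
     (\<exists>K a q Q. enumerates_zeros f K a \<and>
        (\<lambda>k. 1 / norm (a k) ^ (q + 1)) summable_on {k\<in>K. a k \<noteq> 0} \<and>
        (\<forall>r<q. \<not> (\<lambda>k. 1 / norm (a k) ^ (r + 1)) summable_on {k\<in>K. a k \<noteq> 0}) \<and>
        (\<forall>z. f z = z ^ card {k\<in>K. a k = 0} * exp (poly Q z) *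
                (\<Prod>k. if k \<in> K \<and> a k \<noteq> 0 then weierstrass_factor q (z / a k) else 1)) \<and>
        p = max (degree Q) q)"

abbreviation borel_nonneg :: "real measure" where
  "borel_nonneg \<equiv> restrict_space borel {0..}"

definition generalised_stieltjes :: "real \<Rightarrow> (real \<Rightarrow> real) \<Rightarrow> bool" where
  "generalised_stieltjes \<alpha> F \<longleftrightarrow> \<alpha> > 0 \<and>
     (\<exists>\<mu> c. sets \<mu> = sets borel_nonneg \<and> c \<ge> 0 \<and>
        (\<forall>x>0. integrable \<mu> (\<lambda>t. 1 / (t + x) powr \<alpha>) \<and>
               F x = (\<integral>t. 1 / (t + x) powr \<alpha> \<partial>\<mu>) + c))"

(* The sum of the unit point masses at b k, k in K: the image of counting measure on K.
   The points b k are meant to be nonnegative. *)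
definition point_mass_sum :: "nat set \<Rightarrow> (nat \<Rightarrow> real) \<Rightarrow> real measure" where
  "point_mass_sum K b = distr (count_space K) borel_nonneg b"

end

theory Submission
  imports Defs
begin

text \<open>
  Being real on the real axis, \<open>f\<close> satisfies \<open>|f(iy)| = |f(-iy)|\<close>, so with \<open>y = sqrt x\<close> one has
  \<open>2 u(x) = log |f(iy) f(-iy)|\<close>.  Passing to this product removes the odd part of everything in the
  Hadamard representation \<open>f(z) = z^n exp(Q(z)) \<Prod> E\<^sub>q(z/a\<^sub>k)\<close>:

  \<^item> \<open>Re (Q(iy) + Q(-iy))\<close> is a real polynomial \<open>R\<close> in \<open>y\<^sup>2 = x\<close> of degree at most
    \<open>deg Q div 2\<close> (\<open>Re_poly_even_part\<close>);
  \<^item> \<open>E\<^sub>q(z) E\<^sub>q(-z) = E\<^sub>r(z\<^sup>2)\<close> with \<open>r = q div 2\<close> (\<open>weierstrass_factor_mult_minus\<close>).  At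
    \<open>z = iy/a\<^sub>k\<close> with \<open>a\<^sub>k\<close> real the right-hand side is \<open>E\<^sub>r(-b\<^sub>k x)\<close> with \<open>b\<^sub>k = 1/a\<^sub>k\<^sup>2\<close>, a positive
    real number.

  Hence (\<open>ln_norm_imaginary_axis\<close>)
  \<open>2 u(x) = n log x + R(x) + \<Sum>\<^sub>k \<phi>\<^sub>k(x)\<close>, where
  \<open>\<phi>\<^sub>k(x) = log(1 + b\<^sub>k x) + \<Sum>\<^sub>j\<^sub>\<le>\<^sub>r (-b\<^sub>k x)^j / j\<close>.

  The integer \<open>m = p div 2\<close> is at least \<open>deg R\<close> and at least \<open>r\<close>, so \<open>m + 1\<close> differentiations kill all
  the polynomials.  What remains of \<open>\<phi>\<^sub>k\<close> is
  \<open>(-1)^m m! (b\<^sub>k / (1 + b\<^sub>k x))^(m+1) = (-1)^m m! / (a\<^sub>k\<^sup>2 + x)^(m+1)\<close>, and \<open>n log x\<close> contributes the same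
  expression with \<open>a\<^sub>k = 0\<close>, once for each zero at the origin.

  Termwise differentiation is justified by local bounds \<open>C b\<^sub>k^(r+1)\<close> on every derivative of
  \<open>\<phi>\<^sub>k\<close> (\<open>log_factor_deriv_bound\<close>, \<open>log_factor_series\<close>): the series of \<open>b\<^sub>k^(r+1)\<close> converges because
  \<open>2 (r + 1)\<close> is at least \<open>q + 1\<close>.  The zeros in the Hadamard product and those in the measure come
  from two enumerations, which are matched by a bijection (\<open>bij_betw_of_card_fibers\<close>).
\<close>

section \<open>Iterated derivatives\<close>

text \<open>
  Only values on the open set are constrained, which suits a function such as \<open>u\<close> that is
  given on the positive half-line alone.
\<close>

lemma iterated_deriv_from_chain:
  fixes u :: "'a::real_normed_field \<Rightarrow> 'a"
  assumes "open S"
    and G: "\<And>i x. x \<in> S \<Longrightarrow> (G i has_field_derivative G (Suc i) x) (at x)"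
    and u: "\<And>x. x \<in> S \<Longrightarrow> u x = G 0 x"
    and "x \<in> S"
  shows "(deriv ^^ i) u x = G i x"
    and "((deriv ^^ i) u has_field_derivative G (Suc i) x) (at x)"
proof -
  have eq: "\<forall>x\<in>S. (deriv ^^ i) u x = G i x" for i
  proof (induction i)
    case 0
    show ?case using u by simp
  next
    case (Suc i)
    have "((deriv ^^ i) u has_field_derivative G (Suc i) x) (at x)" if "x \<in> S" for x
      using G[OF that] Suc \<open>open S\<close> that
      by (subst DERIV_cong_ev[OF refl _ refl, where g = "G i"])
         (auto simp: eventually_nhds)
    then show ?case by (auto intro: DERIV_imp_deriv)
  qed
  show "(deriv ^^ i) u x = G i x" using eq \<open>x \<in> S\<close> by blast
  show "((deriv ^^ i) u has_field_derivative G (Suc i) x) (at x)"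
    using G[OF \<open>x \<in> S\<close>] eq[of i] \<open>open S\<close> \<open>x \<in> S\<close>
    by (subst DERIV_cong_ev[OF refl _ refl, where g = "G i"])
       (auto simp: eventually_nhds)
qed

lemma higher_pderiv_eq_0:
  fixes P :: "'a::{comm_semiring_1,semiring_no_zero_divisors} poly"
  assumes "degree P < i"
  shows "(pderiv ^^ i) P = 0"
  using assms by (intro poly_eqI) (simp add: coeff_higher_pderiv coeff_eq_0)

text \<open>
  The derivative of order \<open>i\<close> of \<open>x \<mapsto> ln (c + b x)\<close>.  The parameter \<open>c\<close> lets one formula
  cover both \<open>ln x\<close>, for the zero at the origin, and \<open>ln (1 + b x)\<close>, for the other zeros.
\<close>

definition ln_affine_deriv :: "real \<Rightarrow> real \<Rightarrow> nat \<Rightarrow> real \<Rightarrow> real" where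
  "ln_affine_deriv c b i x =
     (if i = 0 then ln (c + b * x)
      else (-1) ^ (i - 1) * fact (i - 1) * (b / (c + b * x)) ^ i)"

lemma has_field_derivative_ln_affine_deriv:
  assumes "c + b * x > 0"
  shows "(ln_affine_deriv c b i has_field_derivative ln_affine_deriv c b (Suc i) x) (at x)"
proof (cases i)
  case 0
  have "((\<lambda>x. ln (c + b * x)) has_field_derivative b / (c + b * x)) (at x)"
    using assms by (auto intro!: derivative_eq_intros)
  then show ?thesis by (simp add: 0 ln_affine_deriv_def[abs_def])
next
  case (Suc j)
  have inner: "((\<lambda>x. b / (c + b * x)) has_field_derivative - ((b / (c + b * x))\<^sup>2)) (at x)"
    using assms by (auto intro!: derivative_eq_intros simp: power2_eq_square)
  have "((\<lambda>x. (-1) ^ j * fact j * (b / (c + b * x)) ^ Suc j) has_field_derivative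
          (-1) ^ j * fact j * (real (Suc j) * (b / (c + b * x)) ^ j * - ((b / (c + b * x))\<^sup>2)))
        (at x)"
    by (intro DERIV_cmult DERIV_cong[OF DERIV_power[OF inner]]) simp
  then show ?thesis
    by (simp add: Suc ln_affine_deriv_def[abs_def] power2_eq_square mult_ac)
qed

section \<open>Logarithms of the primary factors\<close>

definition log_factor_poly :: "nat \<Rightarrow> real \<Rightarrow> real poly" where
  "log_factor_poly r b = (\<Sum>j=1..r. monom ((- b) ^ j / real j) j)"

text \<open>
  The derivative of order \<open>i\<close> of \<open>x \<mapsto> ln E\<^sub>r(-b x)\<close>, where \<open>E\<^sub>r\<close> is the primary factor
  \<open>weierstrass_factor r\<close>.
\<close>

definition log_factor_deriv :: "nat \<Rightarrow> real \<Rightarrow> nat \<Rightarrow> real \<Rightarrow> real" where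
  "log_factor_deriv r b i x =
     ln_affine_deriv 1 b i x + poly ((pderiv ^^ i) (log_factor_poly r b)) x"

lemma degree_log_factor_poly: "degree (log_factor_poly r b) \<le> r"
  unfolding log_factor_poly_def
  by (intro degree_sum_le) (auto intro: order.trans[OF degree_monom_le])

lemma coeff_log_factor_poly:
  "coeff (log_factor_poly r b) i = (if 1 \<le> i \<and> i \<le> r then (- b) ^ i / real i else 0)"
  by (simp add: log_factor_poly_def coeff_sum)

lemma exp_log_factor_deriv_0:
  assumes "1 + b * x > 0"
  shows "complex_of_real (exp (log_factor_deriv r b 0 x)) =
           weierstrass_factor r (complex_of_real (- (b * x)))"
proof -
  have "poly (log_factor_poly r b) x = (\<Sum>j=1..r. (- (b * x)) ^ j / real j)"
    by (simp add: log_factor_poly_def poly_sum poly_monom flip: power_mult_distrib)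
  then show ?thesis
    using assms
    by (simp add: log_factor_deriv_def ln_affine_deriv_def weierstrass_factor_def exp_add
          exp_of_real[symmetric])
qed

lemma has_field_derivative_log_factor_deriv:
  assumes "1 + b * x > 0"
  shows "(log_factor_deriv r b i has_field_derivative log_factor_deriv r b (Suc i) x) (at x)"
  unfolding log_factor_deriv_def[abs_def]
  using DERIV_add[OF has_field_derivative_ln_affine_deriv[OF assms] poly_DERIV] by simp

text \<open>
  The polynomial in \<open>E\<^sub>r\<close> is minus the Taylor polynomial of degree \<open>r\<close> of the logarithm, so the sum
  vanishes to order \<open>r + 1\<close> at the origin.
\<close>

lemma log_factor_deriv_at_0:
  assumes "i \<le> r"
  shows "log_factor_deriv r b i 0 = 0"
proof (cases i)
  case 0
  then show ?thesis
    by (simp add: log_factor_deriv_def ln_affine_deriv_def poly_0_coeff_0 coeff_log_factor_poly)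
next
  case (Suc j)
  have "pochhammer 1 i = (fact i :: real)"
    by (simp add: pochhammer_fact)
  then have "poly ((pderiv ^^ i) (log_factor_poly r b)) 0 = fact i * ((- b) ^ i / real i)"
    using assms Suc by (simp only: poly_0_coeff_0 coeff_higher_pderiv) (simp add: coeff_log_factor_poly)
  also have "\<dots> = - ((-1) ^ j * fact j * b ^ i)"
    using Suc power_minus[of b i] by (simp add: divide_simps)
  finally show ?thesis
    using Suc by (simp add: log_factor_deriv_def ln_affine_deriv_def)
qed

lemma log_factor_deriv_high:
  assumes "r < i"
  shows "log_factor_deriv r b i x = (-1) ^ (i - 1) * fact (i - 1) * (b / (1 + b * x)) ^ i"
  using assms degree_log_factor_poly[of r b]
  by (simp add: log_factor_deriv_def ln_affine_deriv_def higher_pderiv_eq_0)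

lemma divide_one_plus_mult_bounds:
  fixes b x :: real
  assumes "b \<ge> 0" and "x \<ge> 0"
  shows "0 \<le> b / (1 + b * x)" and "b / (1 + b * x) \<le> b"
proof -
  have "b * x \<ge> 0" using assms by simp
  then have "1 \<le> 1 + b * x" "0 < 1 + b * x" by linarith+
  then show "0 \<le> b / (1 + b * x)" and "b / (1 + b * x) \<le> b"
    using assms divide_left_mono[of 1 "1 + b * x" b] by simp_all
qed

text \<open>
  The derivative of order \<open>r + 1\<close> is bounded by \<open>r! b^(r+1)\<close>.  Each lower derivative vanishes at
  the origin, so by the mean value inequality each step down costs only a factor \<open>X\<close>.  This is
  what keeps the exponent of \<open>b\<close> at \<open>r + 1\<close>, although the separate summands of these derivatives
  have size of lower order in \<open>b\<close>.
\<close>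

lemma log_factor_deriv_low_bound:
  assumes "b \<ge> 0" and "d \<le> r + 1" and "0 \<le> x" and "x \<le> X"
  shows "\<bar>log_factor_deriv r b (r + 1 - d) x\<bar> \<le> fact r * b ^ (r + 1) * X ^ d"
  using assms(2-4)
proof (induction d arbitrary: x)
  case 0
  define t where "t = b / (1 + b * x)"
  have t: "0 \<le> t" "t \<le> b"
    unfolding t_def using \<open>b \<ge> 0\<close> 0(2) by (simp_all add: divide_one_plus_mult_bounds)
  have "\<bar>log_factor_deriv r b (r + 1) x\<bar> = fact r * t ^ (r + 1)"
    using t(1) by (simp add: log_factor_deriv_high abs_mult flip: t_def)
  also have "\<dots> \<le> fact r * b ^ (r + 1)"
    using t by (intro mult_left_mono power_mono) simp_all
  finally show ?case by simp
next
  case (Suc d)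
  define i where "i = r + 1 - Suc d"
  have i: "i \<le> r" "Suc i = r + 1 - d" using Suc.prems by (auto simp: i_def)
  have "norm (log_factor_deriv r b i x - log_factor_deriv r b i 0)
          \<le> fact r * b ^ (r + 1) * X ^ d * norm (x - 0)"
  proof (rule field_differentiable_bound[of "{0..x}"])
    fix z assume z: "z \<in> {0..x}"
    then have "1 + b * z > 0" using \<open>b \<ge> 0\<close> by (auto intro: add_pos_nonneg)
    then show "(log_factor_deriv r b i has_field_derivative log_factor_deriv r b (Suc i) z)
                 (at z within {0..x})"
      by (rule has_field_derivative_at_within[OF has_field_derivative_log_factor_deriv])
    show "norm (log_factor_deriv r b (Suc i) z) \<le> fact r * b ^ (r + 1) * X ^ d"
      unfolding i(2) real_norm_def by (rule Suc.IH) (use Suc.prems z in simp_all)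
  qed (use Suc.prems in simp_all)
  also have "norm (x - 0) = x" using Suc.prems by simp
  also have "fact r * b ^ (r + 1) * X ^ d * x \<le> fact r * b ^ (r + 1) * X ^ d * X"
    using Suc.prems \<open>b \<ge> 0\<close> by (intro mult_left_mono mult_nonneg_nonneg zero_le_power) simp_all
  also have "\<dots> = fact r * b ^ (r + 1) * X ^ Suc d" by simp
  finally show ?case
    unfolding log_factor_deriv_at_0[OF i(1)] i_def[symmetric] by simp
qed

text \<open>
  Of the factors \<open>b / (1 + b x)\<close>, the first \<open>r + 1\<close> are estimated by \<open>b\<close> and the other
  \<open>e\<close> by \<open>1 / y\<close>.  The latter is why the bound holds only away from the origin.
\<close>

lemma log_factor_deriv_high_bound:
  assumes "b \<ge> 0" and "0 < y" and "y \<le> x"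
  shows "\<bar>log_factor_deriv r b (r + 1 + e) x\<bar> \<le> fact (r + e) * (1 / y) ^ e * b ^ (r + 1)"
proof -
  define t where "t = b / (1 + b * x)"
  have x: "x > 0" using assms by simp
  have t: "0 \<le> t" "t \<le> b"
    unfolding t_def using assms(1) x by (simp_all add: divide_one_plus_mult_bounds)
  have "b * y \<le> b * x" using assms by (simp add: mult_left_mono)
  moreover have "1 + b * x > 0" using assms x by (intro add_pos_nonneg) auto
  ultimately have ty: "t \<le> 1 / y"
    using assms by (simp add: t_def divide_simps)
  have "t ^ (r + 1 + e) = t ^ e * t ^ (r + 1)" by (simp add: power_add mult_ac)
  also have "\<dots> \<le> (1 / y) ^ e * b ^ (r + 1)"
    using t ty assms by (intro mult_mono power_mono) auto
  finally have le: "t ^ (r + 1 + e) \<le> (1 / y) ^ e * b ^ (r + 1)" .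
  have "\<bar>log_factor_deriv r b (r + 1 + e) x\<bar> = fact (r + e) * t ^ (r + 1 + e)"
    using t(1) by (simp add: log_factor_deriv_high abs_mult flip: t_def)
  also have "\<dots> \<le> fact (r + e) * ((1 / y) ^ e * b ^ (r + 1))"
    by (intro mult_left_mono le) auto
  finally show ?thesis by (simp add: mult_ac)
qed

lemma log_factor_deriv_bound:
  assumes "0 < y"
  shows "\<exists>C. \<forall>b x. 0 \<le> b \<longrightarrow> y \<le> x \<longrightarrow> x \<le> X \<longrightarrow> \<bar>log_factor_deriv r b i x\<bar> \<le> C * b ^ (r + 1)"
proof (cases "i \<le> r + 1")
  case True
  show ?thesis
    using log_factor_deriv_low_bound[of _ "r + 1 - i" r _ X] True assms
    by (intro exI[of _ "fact r * X ^ (r + 1 - i)"]) (auto simp: mult_ac)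
next
  case False
  then obtain e where "i = r + 1 + e" by (metis le_iff_add nat_le_linear)
  then show ?thesis
    using log_factor_deriv_high_bound[OF _ assms] by blast
qed

lemma log_factor_series:
  assumes b: "\<And>k. b k \<ge> 0" and "summable (\<lambda>k. b k ^ (r + 1))" and "x > 0"
  shows "summable (\<lambda>k. log_factor_deriv r (b k) i x)"
    and "((\<lambda>x. \<Sum>k. log_factor_deriv r (b k) i x) has_field_derivative
           (\<Sum>k. log_factor_deriv r (b k) (Suc i) x)) (at x)"
proof -
  define S where "S = {x / 2<..<2 * x}"
  have S: "open S" "convex S" "x \<in> S"
    using \<open>x > 0\<close> by (auto simp: S_def)
  have bound: "\<exists>C. \<forall>k. \<forall>z\<in>S. \<bar>log_factor_deriv r (b k) i z\<bar> \<le> C * b k ^ (r + 1)" for i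
  proof -
    have "x / 2 > 0" using \<open>x > 0\<close> by simp
    from log_factor_deriv_bound[OF this] obtain C where C:
        "\<forall>b z. 0 \<le> b \<longrightarrow> x / 2 \<le> z \<longrightarrow> z \<le> 2 * x \<longrightarrow>
          \<bar>log_factor_deriv r b i z\<bar> \<le> C * b ^ (r + 1)"
      by blast
    have "\<bar>log_factor_deriv r (b k) i z\<bar> \<le> C * b k ^ (r + 1)" if "z \<in> S" for k z
      using C[rule_format, of "b k" z] b[of k] that by (simp add: S_def)
    then show ?thesis by blast
  qed
  have sum: "summable (\<lambda>k. log_factor_deriv r (b k) i x)" for i
  proof -
    obtain C where "\<forall>k. \<bar>log_factor_deriv r (b k) i x\<bar> \<le> C * b k ^ (r + 1)"
      using bound[of i] \<open>x \<in> S\<close> by blast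
    then show ?thesis
      by (intro summable_comparison_test'[OF summable_mult[OF assms(2), of C]])
         (simp only: real_norm_def)
  qed
  show "summable (\<lambda>k. log_factor_deriv r (b k) i x)" by (rule sum)
  obtain C where C: "\<forall>k. \<forall>z\<in>S. \<bar>log_factor_deriv r (b k) (Suc i) z\<bar> \<le> C * b k ^ (r + 1)"
    using bound[of "Suc i"] by blast
  show "((\<lambda>x. \<Sum>k. log_factor_deriv r (b k) i x) has_field_derivative
           (\<Sum>k. log_factor_deriv r (b k) (Suc i) x)) (at x)"
  proof (rule has_field_derivative_series'(2)[OF \<open>convex S\<close>])
    fix k z assume "z \<in> S"
    then have "1 + b k * z > 0"
      using b[of k] \<open>x > 0\<close> by (intro add_pos_nonneg) (auto simp: S_def)
    then show "(log_factor_deriv r (b k) i has_field_derivative log_factor_deriv r (b k) (Suc i) z)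
                 (at z within S)"
      by (rule has_field_derivative_at_within[OF has_field_derivative_log_factor_deriv])
  next
    show "uniformly_convergent_on S (\<lambda>n z. \<Sum>k<n. log_factor_deriv r (b k) (Suc i) z)"
      by (rule Weierstrass_m_test'[OF _ summable_mult[OF assms(2), of C]])
         (simp only: real_norm_def C)
  qed (use S sum in \<open>auto simp: interior_open\<close>)
qed

section \<open>Even parts of Weierstrass products\<close>

text \<open>
  The odd powers in the two exponents cancel and the even ones double, which turns \<open>z^(2j) / (2j)\<close>
  into \<open>(z\<^sup>2)^j / j\<close>.
\<close>

lemma weierstrass_factor_mult_minus:
  "weierstrass_factor q z * weierstrass_factor q (- z) = weierstrass_factor (q div 2) (z\<^sup>2)"
proof -
  have "(\<Sum>k=1..q. z ^ k / of_nat k) + (\<Sum>k=1..q. (- z) ^ k / of_nat k) =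
          (\<Sum>j=1..q div 2. (z\<^sup>2) ^ j / of_nat j)"
  proof (induction q)
    case (Suc q)
    show ?case
    proof (cases "even q")
      case True
      then show ?thesis using Suc by simp
    next
      case False
      then obtain t where t: "q = Suc (2 * t)" by (metis oddE Suc_eq_plus1)
      have "z ^ Suc q / of_nat (Suc q) + (- z) ^ Suc q / of_nat (Suc q) =
              (z\<^sup>2) ^ Suc t / of_nat (Suc t)"
      proof -
        have "even (Suc q)" using False by simp
        then have p: "(- z) ^ Suc q = z ^ Suc q" by (simp only: uminus_power_if if_True)
        have p': "z ^ Suc q = (z\<^sup>2) ^ Suc t"
          by (simp only: power_mult[symmetric] t) simp
        have "of_nat (Suc q) = 2 * (of_nat (Suc t) :: complex)"
          by (simp add: t)
        moreover have "A / (2 * B) + A / (2 * B) = A / B" for A B :: complex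
          by (simp flip: add_divide_distrib)
        ultimately show ?thesis unfolding p p' by (simp only:)
      qed
      moreover have "q div 2 = t" "Suc q div 2 = Suc t" by (simp_all add: t)
      ultimately show ?thesis using Suc by (simp del: of_nat_Suc power_Suc) (simp add: algebra_simps)
    qed
  qed simp
  then show ?thesis
    by (simp add: weierstrass_factor_def exp_add[symmetric] power2_eq_square algebra_simps)
qed

lemma eventually_norm_less_of_summable_power:
  fixes w :: "nat \<Rightarrow> 'a::real_normed_vector"
  assumes "summable (\<lambda>k. norm (w k) ^ n)" and "e > 0"
  shows "eventually (\<lambda>k. norm (w k) < e) sequentially"
proof -
  have "(\<lambda>k. norm (w k) ^ n) \<longlonglongrightarrow> 0" by (rule summable_LIMSEQ_zero[OF assms(1)])
  then have "eventually (\<lambda>k. norm (w k) ^ n < e ^ n) sequentially"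
    using assms by (intro order_tendstoD(2)) auto
  then show ?thesis
    by eventually_elim (use assms(2) in \<open>auto intro: power_less_imp_less_base\<close>)
qed

lemma weierstrass_product_LIMSEQ:
  assumes "summable (\<lambda>k. norm (w k) ^ (q + 1))"
  shows "(\<lambda>n. \<Prod>k\<le>n. weierstrass_factor q (z * w k)) \<longlonglongrightarrow> (\<Prod>k. weierstrass_factor q (z * w k))"
proof -
  have "eventually (\<lambda>k. norm (w k) < 1 / (2 * (norm z + 1))) sequentially"
    by (rule eventually_norm_less_of_summable_power[OF assms])
       (auto intro!: divide_pos_pos add_nonneg_pos)
  then have "eventually (\<lambda>k. norm (norm (weierstrass_factor q (z * w k) - 1)) \<le>
               3 * norm z ^ (q + 1) * norm (w k) ^ (q + 1)) sequentially"
  proof eventually_elim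
    case (elim k)
    have pos: "norm z + 1 > 0" by (intro add_nonneg_pos) auto
    have "norm z * norm (w k) \<le> (norm z + 1) * (1 / (2 * (norm z + 1)))"
      using elim by (intro mult_mono) auto
    also have "\<dots> = 1 / 2" using pos by simp
    finally have "norm (z * w k) \<le> 1 / 2" by (simp add: norm_mult)
    from weierstrass_factor_bound[OF this, of q] show ?case
      by (simp add: norm_mult power_mult_distrib mult_ac)
  qed
  then have "summable (\<lambda>k. norm (weierstrass_factor q (z * w k) - 1))"
    by (rule summable_comparison_test_ev[OF _ summable_mult[OF assms]])
  then show ?thesis
    by (intro convergent_prod_LIMSEQ abs_convergent_prod_imp_convergent_prod
        summable_imp_abs_convergent_prod)
qed

text \<open>
  Eventually \<open>|v k| < 1\<close>, and \<open>2 (q div 2 + 1)\<close> is at least \<open>q + 1\<close>.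
\<close>

lemma summable_square_power:
  fixes v :: "nat \<Rightarrow> real"
  assumes "summable (\<lambda>k. \<bar>v k\<bar> ^ (q + 1))"
  shows "summable (\<lambda>k. ((v k)\<^sup>2) ^ (q div 2 + 1))"
proof -
  have "eventually (\<lambda>k. norm (v k) < 1) sequentially"
    using assms by (intro eventually_norm_less_of_summable_power[of v "q + 1"]) auto
  then have "eventually (\<lambda>k. norm (((v k)\<^sup>2) ^ (q div 2 + 1)) \<le> \<bar>v k\<bar> ^ (q + 1)) sequentially"
  proof eventually_elim
    case (elim k)
    have "((v k)\<^sup>2) ^ (q div 2 + 1) = \<bar>v k\<bar> ^ (2 * (q div 2 + 1))"
      by (simp only: power_mult power2_abs)
    also have "\<dots> \<le> \<bar>v k\<bar> ^ (q + 1)"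
      using elim by (intro power_decreasing) auto
    finally show ?case by simp
  qed
  then show ?thesis by (rule summable_comparison_test_ev[OF _ assms])
qed

text \<open>
  The factors at \<open>z = i sqrt x\<close> and \<open>-z\<close> are paired inside the partial products, where
  multiplication is finite; the limit is taken only afterwards.
\<close>

lemma norm_weierstrass_product_imaginary:
  fixes v :: "nat \<Rightarrow> real"
  assumes sum: "summable (\<lambda>k. \<bar>v k\<bar> ^ (q + 1))" and "x > 0"
  shows "cmod (\<Prod>k. weierstrass_factor q (\<i> * sqrt x * v k)) *
         cmod (\<Prod>k. weierstrass_factor q (- (\<i> * sqrt x) * v k)) =
           exp (\<Sum>k. log_factor_deriv (q div 2) ((v k)\<^sup>2) 0 x)"
proof -
  define z where "z = \<i> * complex_of_real (sqrt x)"
  define \<phi> where "\<phi> k = log_factor_deriv (q div 2) ((v k)\<^sup>2) 0 x" for k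
  have sum': "summable (\<lambda>k. norm (complex_of_real (v k)) ^ (q + 1))" using sum by simp
  have factor: "weierstrass_factor q (z * v k) * weierstrass_factor q (- z * v k) =
                  complex_of_real (exp (\<phi> k))" for k
  proof -
    have z2: "z\<^sup>2 = - complex_of_real x"
      using \<open>x > 0\<close> by (simp add: z_def power_mult_distrib of_real_power[symmetric] del: of_real_power)
    have "weierstrass_factor q (z * v k) * weierstrass_factor q (- z * v k) =
            weierstrass_factor (q div 2) ((z * v k)\<^sup>2)"
      using weierstrass_factor_mult_minus[of q "z * v k"] by simp
    also have "(z * v k)\<^sup>2 = complex_of_real (- ((v k)\<^sup>2 * x))"
      by (simp add: power_mult_distrib z2)
    also have "weierstrass_factor (q div 2) \<dots> = complex_of_real (exp (\<phi> k))"
      unfolding \<phi>_def using \<open>x > 0\<close>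
      by (intro exp_log_factor_deriv_0[symmetric] add_pos_nonneg) auto
    finally show ?thesis .
  qed
  have "(\<lambda>n. cmod (\<Prod>k\<le>n. weierstrass_factor q (z * v k)) *
             cmod (\<Prod>k\<le>n. weierstrass_factor q (- z * v k)))
          \<longlonglongrightarrow> cmod (\<Prod>k. weierstrass_factor q (z * v k)) *
             cmod (\<Prod>k. weierstrass_factor q (- z * v k))"
    by (intro tendsto_mult tendsto_norm weierstrass_product_LIMSEQ sum')
  moreover have "cmod (\<Prod>k\<le>n. weierstrass_factor q (z * v k)) *
                 cmod (\<Prod>k\<le>n. weierstrass_factor q (- z * v k)) = exp (\<Sum>k\<le>n. \<phi> k)" for n
  proof -
    have "cmod (\<Prod>k\<le>n. weierstrass_factor q (z * v k)) *
          cmod (\<Prod>k\<le>n. weierstrass_factor q (- z * v k)) =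
            cmod (complex_of_real (\<Prod>k\<le>n. exp (\<phi> k)))"
      by (simp only: norm_mult[symmetric] prod.distrib[symmetric] factor of_real_prod)
    also have "\<dots> = exp (\<Sum>k\<le>n. \<phi> k)"
      by (simp only: norm_of_real) (simp add: exp_sum abs_prod)
    finally show ?thesis .
  qed
  moreover have "(\<lambda>n. exp (\<Sum>k\<le>n. \<phi> k)) \<longlonglongrightarrow> exp (\<Sum>k. \<phi> k)"
  proof (rule tendsto_exp)
    have "summable \<phi>"
      unfolding \<phi>_def
      by (rule log_factor_series(1)[OF _ summable_square_power[OF sum] \<open>x > 0\<close>]) simp
    then show "(\<lambda>n. \<Sum>k\<le>n. \<phi> k) \<longlonglongrightarrow> (\<Sum>k. \<phi> k)"
      by (rule summable_LIMSEQ')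
  qed
  ultimately have "cmod (\<Prod>k. weierstrass_factor q (z * v k)) *
             cmod (\<Prod>k. weierstrass_factor q (- z * v k)) = exp (\<Sum>k. \<phi> k)"
    by (simp only:) (rule LIMSEQ_unique)
  then show ?thesis unfolding z_def \<phi>_def .
qed

text \<open>
  The sum \<open>Q(z) + Q(-z)\<close> retains only even powers of \<open>z\<close>, which on the imaginary axis are real
  and are powers of \<open>-y\<^sup>2\<close>; the real part then replaces the coefficients of \<open>Q\<close> by their real
  parts.
\<close>

lemma Re_poly_even_part:
  fixes Q :: "complex poly"
  obtains R :: "real poly"
  where "degree R \<le> degree Q div 2"
    and "\<And>y::real. Re (poly Q (\<i> * y)) + Re (poly Q (- (\<i> * y))) = poly R (y\<^sup>2)"
proof
  define d where "d = degree Q div 2"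
  define R where "R = (\<Sum>j\<le>d. monom (2 * (-1) ^ j * Re (coeff Q (2 * j))) j)"
  show "degree R \<le> degree Q div 2"
    unfolding R_def d_def[symmetric]
    by (intro degree_sum_le) (auto intro: order.trans[OF degree_monom_le])
  fix y :: real
  have Q: "poly Q z = (\<Sum>j\<le>d. coeff Q (2 * j) * z ^ (2 * j) + coeff Q (Suc (2 * j)) * z ^ Suc (2 * j))"
    for z
  proof -
    have "poly Q z = (\<Sum>k\<le>Suc (2 * d). coeff Q k * z ^ k)"
      unfolding poly_altdef
      by (rule sum.mono_neutral_left) (auto simp: d_def coeff_eq_0)
    then show ?thesis by (simp only: sum.in_pairs_0)
  qed
  have "poly Q (\<i> * y) + poly Q (- (\<i> * y)) =
          (\<Sum>j\<le>d. 2 * coeff Q (2 * j) * (\<i> * y) ^ (2 * j))"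
    unfolding Q sum.distrib[symmetric] by (intro sum.cong) auto
  also have "\<dots> = (\<Sum>j\<le>d. complex_of_real (2 * (-1) ^ j * (y\<^sup>2) ^ j) * coeff Q (2 * j))"
    by (intro sum.cong) (auto simp: power_mult power_mult_distrib power_minus[of "(complex_of_real y)\<^sup>2"])
  finally have "poly Q (\<i> * y) + poly Q (- (\<i> * y)) =
          (\<Sum>j\<le>d. complex_of_real (2 * (-1) ^ j * (y\<^sup>2) ^ j) * coeff Q (2 * j))" .
  then have "Re (poly Q (\<i> * y) + poly Q (- (\<i> * y))) =
          (\<Sum>j\<le>d. Re (complex_of_real (2 * (-1) ^ j * (y\<^sup>2) ^ j) * coeff Q (2 * j)))"
    by (simp only: Re_sum)
  also have "\<dots> = (\<Sum>j\<le>d. 2 * (-1) ^ j * Re (coeff Q (2 * j)) * (y\<^sup>2) ^ j)"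
    by (intro sum.cong refl) (simp only: Re_complex_of_real times_complex.sel Im_complex_of_real, simp)
  finally have "Re (poly Q (\<i> * y)) + Re (poly Q (- (\<i> * y))) =
          (\<Sum>j\<le>d. 2 * (-1) ^ j * Re (coeff Q (2 * j)) * (y\<^sup>2) ^ j)"
    by (simp only: plus_complex.sel)
  then show "Re (poly Q (\<i> * y)) + Re (poly Q (- (\<i> * y))) = poly R (y\<^sup>2)"
    by (simp only: R_def poly_sum poly_monom)
qed

text \<open>
  The reflection principle: \<open>z \<mapsto> cnj (f (cnj z))\<close> is entire and agrees with \<open>f\<close> on the real axis.
\<close>

lemma real_entire_cnj:
  assumes "real_entire f"
  shows "f (cnj z) = cnj (f z)"
proof -
  have hol: "f holomorphic_on UNIV" and real: "\<And>x::real. f (of_real x) \<in> \<real>"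
    using assms by (auto simp: real_entire_def)
  have "(cnj \<circ> f \<circ> cnj) holomorphic_on UNIV"
    using hol by (intro holomorphic_on_compose_cnj_cnj) (auto intro: holomorphic_on_subset)
  then have hol': "(\<lambda>z. cnj (f (cnj z)) - f z) holomorphic_on UNIV"
    using hol by (auto intro!: holomorphic_intros simp: o_def)
  have "cnj (f (cnj (cnj z))) - f (cnj z) = 0"
  proof (rule analytic_continuation[OF hol', of \<real> 0])
    show "(0::complex) islimpt \<real>"
    proof (rule islimptI)
      fix T :: "complex set" assume "0 \<in> T" "open T"
      then obtain e where "e > 0" "ball 0 e \<subseteq> T" by (auto simp: open_contains_ball)
      then show "\<exists>y\<in>\<real>. y \<in> T \<and> y \<noteq> 0"
        by (intro bexI[of _ "complex_of_real (e / 2)"]) auto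
    qed
  next
    fix z :: complex assume "z \<in> \<real>"
    then obtain r where "z = complex_of_real r" by (elim Reals_cases)
    then show "cnj (f (cnj z)) - f z = 0"
      using real[of r] by (simp add: Reals_cnj_iff)
  qed auto
  then show ?thesis by simp
qed

section \<open>Enumerations and point masses\<close>

text \<open>
  Two enumerations of the same multiset differ by a relabelling, obtained by choosing a bijection
  between the fibres over each value.
\<close>

lemma bij_betw_of_card_fibers:
  assumes fin: "\<And>z. finite {k\<in>K. a k = z}" "\<And>z. finite {k\<in>L. c k = z}"
    and card: "\<And>z. card {k\<in>K. a k = z} = card {k\<in>L. c k = z}"
  obtains g where "bij_betw g K L" and "\<And>k. k \<in> K \<Longrightarrow> c (g k) = a k"
proof -
  have "\<exists>h. bij_betw h {k\<in>K. a k = z} {k\<in>L. c k = z}" for z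
    by (intro finite_same_card_bij fin card)
  then obtain h where h: "\<And>z. bij_betw (h z) {k\<in>K. a k = z} {k\<in>L. c k = z}" by metis
  define g where "g k = h (a k) k" for k
  have g: "g k \<in> L" "c (g k) = a k" if "k \<in> K" for k
    using bij_betwE[OF h[of "a k"]] that by (auto simp: g_def)
  have "inj_on g K"
  proof (rule inj_onI)
    fix j k assume jk: "j \<in> K" "k \<in> K" "g j = g k"
    then have "a j = a k" using g by metis
    then show "j = k"
      using jk bij_betw_imp_inj_on[OF h[of "a k"]] by (auto simp: g_def inj_on_def)
  qed
  moreover have "g ` K = L"
  proof
    show "g ` K \<subseteq> L" using g by auto
    show "L \<subseteq> g ` K"
    proof
      fix l assume "l \<in> L"
      then have "l \<in> h (c l) ` {k\<in>K. a k = c l}"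
        using bij_betw_imp_surj_on[OF h[of "c l"]] by auto
      then obtain k where "k \<in> K" "a k = c l" "l = h (c l) k" by blast
      then show "l \<in> g ` K" by (intro image_eqI[of _ _ k]) (simp_all add: g_def)
    qed
  qed
  ultimately show ?thesis using that g by (auto simp: bij_betw_def)
qed

lemma integral_count_space_nat_subset:
  fixes h :: "nat \<Rightarrow> real"
  assumes "(\<lambda>k. if k \<in> A then h k else 0) sums s" and "\<And>k. k \<in> A \<Longrightarrow> h k \<ge> 0"
  shows "integrable (count_space A) h" and "(\<integral>k. h k \<partial>count_space A) = s"
proof -
  let ?h = "\<lambda>k. indicator A k *\<^sub>R h k"
  have eq: "(\<lambda>k. if k \<in> A then h k else 0) = ?h" by (auto simp: fun_eq_iff indicator_def)
  have A: "count_space A = restrict_space (count_space UNIV) A"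
    by (simp add: restrict_count_space)
  have int: "integrable (count_space UNIV) ?h"
    unfolding integrable_count_space_nat_iff
    using assms sums_summable[OF assms(1)[unfolded eq]]
    by (auto simp: indicator_def cong: if_cong)
  then show "integrable (count_space A) h"
    unfolding A by (subst integrable_restrict_space) auto
  show "(\<integral>k. h k \<partial>count_space A) = s"
    unfolding A using int assms(1)[unfolded eq]
    by (subst integral_restrict_space) (auto simp: integral_count_space_nat sums_iff)
qed

lemma stieltjes_kernel_measurable [measurable]:
  "(\<lambda>t. 1 / (t + x) ^ n :: real) \<in> borel_measurable borel_nonneg"
  by (intro measurable_restrict_space1) measurable

lemma
  assumes "\<And>k. k \<in> K \<Longrightarrow> b k \<ge> 0"
  shows integrable_point_mass_sum:
      "integrable (point_mass_sum K b) (\<lambda>t. 1 / (t + x) ^ n) \<longleftrightarrow>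
         integrable (count_space K) (\<lambda>k. 1 / (b k + x) ^ n)"
    and integral_point_mass_sum:
      "(\<integral>t. 1 / (t + x) ^ n \<partial>point_mass_sum K b) = (\<integral>k. 1 / (b k + x) ^ n \<partial>count_space K)"
proof -
  have b: "b \<in> measurable (count_space K) borel_nonneg"
    using assms by (auto simp: space_restrict_space)
  show "integrable (point_mass_sum K b) (\<lambda>t. 1 / (t + x) ^ n) \<longleftrightarrow>
         integrable (count_space K) (\<lambda>k. 1 / (b k + x) ^ n)"
    unfolding point_mass_sum_def by (subst integrable_distr_eq[OF b]) auto
  show "(\<integral>t. 1 / (t + x) ^ n \<partial>point_mass_sum K b) = (\<integral>k. 1 / (b k + x) ^ n \<partial>count_space K)"
    unfolding point_mass_sum_def by (subst integral_distr[OF b]) auto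
qed

text \<open>
  The definition asks for an unscaled integral, so the constant factor is moved into the measure as a
  constant density.
\<close>

lemma generalised_stieltjesI:
  fixes \<mu> :: "real measure"
  assumes sets: "sets \<mu> = sets borel_nonneg" and "c \<ge> 0" and "n > 0"
    and int: "\<And>x. x > 0 \<Longrightarrow> integrable \<mu> (\<lambda>t. 1 / (t + x) ^ n)"
    and F: "\<And>x. x > 0 \<Longrightarrow> F x = c * (\<integral>t. 1 / (t + x) ^ n \<partial>\<mu>)"
  shows "generalised_stieltjes (real n) F"
  unfolding generalised_stieltjes_def
proof (intro conjI exI allI impI)
  let ?\<nu> = "density \<mu> (\<lambda>_. ennreal c)"
  show "real n > 0" using \<open>n > 0\<close> by simp
  show "sets ?\<nu> = sets borel_nonneg" using sets by simp
  show "(0::real) \<le> 0" by simp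
  fix x :: real assume x: "x > 0"
  have sp: "space ?\<nu> = {0..}" "space \<mu> = {0..}"
    using sets_eq_imp_space_eq[OF sets] by (auto simp: space_restrict_space)
  have powr: "1 / (t + x) powr real n = 1 / (t + x) ^ n" if "t \<in> {0..}" for t
    using that x by (subst powr_realpow) auto
  have meas: "(\<lambda>t. 1 / (t + x) ^ n) \<in> borel_measurable \<mu>"
    using stieltjes_kernel_measurable sets by (simp cong: measurable_cong_sets)
  have "integrable ?\<nu> (\<lambda>t. 1 / (t + x) ^ n)"
    using integrable_mult_right[OF int[OF x], of c] meas \<open>c \<ge> 0\<close>
    by (subst integrable_density) auto
  then show "integrable ?\<nu> (\<lambda>t. 1 / (t + x) powr real n)"
    by (subst Bochner_Integration.integrable_cong[OF refl]) (auto simp: sp powr)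
  have "(\<integral>t. 1 / (t + x) powr real n \<partial>?\<nu>) = (\<integral>t. 1 / (t + x) ^ n \<partial>?\<nu>)"
    by (intro Bochner_Integration.integral_cong) (auto simp: sp powr)
  also have "\<dots> = F x"
    using meas \<open>c \<ge> 0\<close> F[OF x]
    by (subst integral_density) (auto simp flip: integral_mult_right_zero)
  finally show "F x = (\<integral>t. 1 / (t + x) powr real n \<partial>?\<nu>) + 0" by simp
qed

section \<open>The logarithm of the modulus on the imaginary axis\<close>

text \<open>
  The numbers \<open>v k\<close> stand for the reciprocals of the real nonzero zeros.  Taking reciprocals allows
  indices that carry no nonzero zero to be included with \<open>v k = 0\<close>, where the factor is 1.
\<close>

lemma ln_norm_imaginary_axis:
  fixes v :: "nat \<Rightarrow> real"
  assumes "real_entire f"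
    and f: "\<And>z::complex. f z = z ^ n * exp (poly Q z) * (\<Prod>k. weierstrass_factor q (z * v k))"
    and sum: "summable (\<lambda>k. \<bar>v k\<bar> ^ (q + 1))"
    and R: "\<And>y::real. Re (poly Q (\<i> * y)) + Re (poly Q (- (\<i> * y))) = poly R (y\<^sup>2)"
    and "x > 0"
  shows "2 * ln (cmod (f (\<i> * sqrt x))) =
           n * ln x + poly R x + (\<Sum>k. log_factor_deriv (q div 2) ((v k)\<^sup>2) 0 x)"
    (is "_ = ?rhs")
proof -
  define z where "z = \<i> * complex_of_real (sqrt x)"
  define P where "P z = (\<Prod>k. weierstrass_factor q (z * v k))" for z :: complex
  have fP: "f z = z ^ n * exp (poly Q z) * P z" for z
    unfolding P_def by (rule f)
  have "cmod (f (- z)) = cmod (f z)"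
  proof -
    have "- z = cnj z" by (simp add: z_def)
    then show ?thesis using real_entire_cnj[OF assms(1), of z] by simp
  qed
  then have "cmod (f z) ^ 2 = cmod (f z) * cmod (f (- z))"
    by (simp add: power2_eq_square)
  also have "\<dots> = (cmod z ^ 2) ^ n * (exp (Re (poly Q z)) * exp (Re (poly Q (- z)))) *
                     (cmod (P z) * cmod (P (- z)))"
    by (simp add: fP norm_mult norm_power power2_eq_square power_mult_distrib)
  also have "cmod z ^ 2 = x" using \<open>x > 0\<close> by (simp add: z_def norm_mult)
  also have "exp (Re (poly Q z)) * exp (Re (poly Q (- z))) = exp (poly R x)"
    using R[of "sqrt x"] \<open>x > 0\<close> by (simp add: z_def flip: exp_add)
  also have "cmod (P z) * cmod (P (- z)) = exp (\<Sum>k. log_factor_deriv (q div 2) ((v k)\<^sup>2) 0 x)"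
    unfolding P_def z_def by (rule norm_weierstrass_product_imaginary[OF sum \<open>x > 0\<close>])
  also have "x ^ n = exp (n * ln x)" using \<open>x > 0\<close> by (simp add: exp_of_nat_mult)
  finally have sq: "cmod (f z) ^ 2 = exp ?rhs" by (simp add: exp_add)
  then have "cmod (f z) \<noteq> 0" by auto
  then have "ln (cmod (f z) ^ 2) = 2 * ln (cmod (f z))" by (simp add: ln_realpow)
  with sq show ?thesis by (simp add: z_def)
qed

text \<open>
  The second part isolates the contribution of the nonzero zeros; the zero of order \<open>n\<close> at
  the origin accounts for the subtracted term.
\<close>

lemma iterated_deriv_ln_norm_imaginary_axis:
  fixes v :: "nat \<Rightarrow> real"
  assumes "real_entire f"
    and f: "\<And>z::complex. f z = z ^ n * exp (poly Q z) * (\<Prod>k. weierstrass_factor q (z * v k))"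
    and sum: "summable (\<lambda>k. \<bar>v k\<bar> ^ (q + 1))"
    and u: "\<And>x. x > 0 \<Longrightarrow> u x = ln (cmod (f (\<i> * complex_of_real (sqrt x))))"
    and "x > 0"
  shows "((deriv ^^ j) u) differentiable (at x)"
    and "degree Q div 2 \<le> m \<Longrightarrow> q div 2 \<le> m \<Longrightarrow>
           (\<lambda>k. ((v k)\<^sup>2 / (1 + (v k)\<^sup>2 * x)) ^ (m + 1)) sums
             (2 * (-1) ^ m * (deriv ^^ (m + 1)) u x / fact m - n * (1 / x) ^ (m + 1))"
proof -
  obtain R :: "real poly" where R: "degree R \<le> degree Q div 2"
      "\<And>y::real. Re (poly Q (\<i> * y)) + Re (poly Q (- (\<i> * y))) = poly R (y\<^sup>2)"
    using Re_poly_even_part by blast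
  \<comment> \<open>\<open>G i\<close> is the derivative of order \<open>i\<close> of \<open>u\<close>; the half undoes the doubling in
    \<open>ln_norm_imaginary_axis\<close>.\<close>
  define L where "L i x = (\<Sum>k. log_factor_deriv (q div 2) ((v k)\<^sup>2) i x)" for i x
  define G where "G i x = (n * ln_affine_deriv 0 1 i x + poly ((pderiv ^^ i) R) x + L i x) / 2" for i x
  note series = log_factor_series[OF _ summable_square_power[OF sum]]
  have G: "(G i has_field_derivative G (Suc i) x) (at x)" if "x \<in> {0<..}" for i x
    unfolding G_def[abs_def] L_def
    using that series(2)[of x i] poly_DERIV[of "(pderiv ^^ i) R" x]
    by (auto intro!: DERIV_cdivide DERIV_add DERIV_cmult has_field_derivative_ln_affine_deriv)
  have u0: "u x = G 0 x" if "x \<in> {0<..}" for x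
    using that ln_norm_imaginary_axis[OF assms(1) f sum R(2), of x] u[of x]
    by (simp add: G_def L_def ln_affine_deriv_def)
  note chain = iterated_deriv_from_chain[where S = "{0<..}", OF open_greaterThan G u0]
  show "((deriv ^^ j) u) differentiable (at x)"
    using chain(2)[of x j] \<open>x > 0\<close> by (auto simp: real_differentiable_def)
  assume m: "degree Q div 2 \<le> m" "q div 2 \<le> m"
  have summand: "log_factor_deriv (q div 2) ((v k)\<^sup>2) (m + 1) x =
                (-1) ^ m * fact m * ((v k)\<^sup>2 / (1 + (v k)\<^sup>2 * x)) ^ (m + 1)" for k
    using m by (simp add: log_factor_deriv_high)
  have "(\<lambda>k. (-1) ^ m / fact m * log_factor_deriv (q div 2) ((v k)\<^sup>2) (m + 1) x) sums
          ((-1) ^ m / fact m * L (m + 1) x)"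
    unfolding L_def using series(1)[of x "m + 1"] \<open>x > 0\<close> by (intro sums_mult summable_sums) auto
  also have "(\<lambda>k. (-1) ^ m / fact m * log_factor_deriv (q div 2) ((v k)\<^sup>2) (m + 1) x) =
               (\<lambda>k. ((v k)\<^sup>2 / (1 + (v k)\<^sup>2 * x)) ^ (m + 1))"
    unfolding summand by (simp add: fun_eq_iff flip: power_mult_distrib)
  also have "(-1) ^ m / fact m * L (m + 1) x =
               2 * (-1) ^ m * (deriv ^^ (m + 1)) u x / fact m - n * (1 / x) ^ (m + 1)"
  proof -
    have "(deriv ^^ (m + 1)) u x = G (m + 1) x" using chain(1)[of x "m + 1"] \<open>x > 0\<close> by simp
    also have "\<dots> = (n * ((-1) ^ m * fact m * (1 / x) ^ (m + 1)) + L (m + 1) x) / 2"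
    proof -
      have "(pderiv ^^ (m + 1)) R = 0" using m R(1) by (intro higher_pderiv_eq_0) linarith
      then have "poly ((pderiv ^^ (m + 1)) R) x = 0" by (simp only: poly_0)
      then show ?thesis unfolding G_def by (simp add: ln_affine_deriv_def del: funpow.simps)
    qed
    finally have D: "2 * (deriv ^^ (m + 1)) u x =
        n * ((-1) ^ m * fact m * (1 / x) ^ (m + 1)) + L (m + 1) x"
      by (simp only:) simp
    have sign: "(-1) ^ m * (-1) ^ m = (1::real)"
      by (simp flip: power_mult_distrib)
    have "2 * (-1) ^ m * (deriv ^^ (m + 1)) u x =
            ((-1) ^ m * (-1) ^ m) * (real n * fact m * (1 / x) ^ (m + 1)) + (-1) ^ m * L (m + 1) x"
      using arg_cong[OF D, of "\<lambda>t. (-1) ^ m * t"] by (simp only: algebra_simps)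
    then show ?thesis
      by (simp only: sign) (simp add: diff_divide_distrib add_divide_distrib del: funpow.simps power_Suc)
  qed
  finally show "(\<lambda>k. ((v k)\<^sup>2 / (1 + (v k)\<^sup>2 * x)) ^ (m + 1)) sums
             (2 * (-1) ^ m * (deriv ^^ (m + 1)) u x / fact m - n * (1 / x) ^ (m + 1))" .
qed

theorem proposition3p1:
  fixes f :: "complex \<Rightarrow> complex" and p m :: nat
    and K :: "nat set" and lam :: "nat \<Rightarrow> real"
    and u :: "real \<Rightarrow> real" and \<mu> :: "real measure"
  assumes "real_entire f"
    and "has_genus f p"
    and "enumerates_zeros f K (\<lambda>k. complex_of_real (lam k))"
    and "\<And>x. x > 0 \<Longrightarrow> u x = ln (cmod (f (\<i> * complex_of_real (sqrt x))))"
    and "m = p div 2"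
    and "\<mu> = point_mass_sum K (\<lambda>k. (lam k)\<^sup>2)"
  shows "(\<forall>j\<le>m. \<forall>x>0. ((deriv ^^ j) u) differentiable (at x)) \<and>
         generalised_stieltjes (real (m + 1)) (\<lambda>x. (-1) ^ m * (deriv ^^ (m + 1)) u x) \<and>
         (\<forall>x>0. integrable \<mu> (\<lambda>t. 1 / (t + x) ^ (m + 1)) \<and>
                (-1) ^ m * (deriv ^^ (m + 1)) u x
                  = fact m / 2 * (\<integral>t. 1 / (t + x) ^ (m + 1) \<partial>\<mu>))"
proof -
  obtain K' a q Q where enum: "enumerates_zeros f K' a"
    and summable_on: "(\<lambda>k. 1 / norm (a k) ^ (q + 1)) summable_on {k\<in>K'. a k \<noteq> 0}"
    and f: "\<And>z. f z = z ^ card {k\<in>K'. a k = 0} * exp (poly Q z) *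
                (\<Prod>k. if k \<in> K' \<and> a k \<noteq> 0 then weierstrass_factor q (z / a k) else 1)"
    and p: "p = max (degree Q) q"
    using \<open>has_genus f p\<close> unfolding has_genus_def by blast
  define n where "n = card {k\<in>K'. a k = 0}"
  have fin0: "finite {k\<in>K'. a k = 0}"
    using enum unfolding enumerates_zeros_def by blast
  have fin: "finite {k\<in>K. complex_of_real (lam k) = z}" "finite {k\<in>K'. a k = z}" for z
    using enum assms(3) unfolding enumerates_zeros_def by blast+
  have card: "card {k\<in>K. complex_of_real (lam k) = z} = card {k\<in>K'. a k = z}" for z
  proof -
    have "int (card {k\<in>K. complex_of_real (lam k) = z}) = int (card {k\<in>K'. a k = z})"
      using enum assms(3) unfolding enumerates_zeros_def by simp
    then show ?thesis by simp
  qed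
  obtain g where g: "bij_betw g K K'" "\<And>k. k \<in> K \<Longrightarrow> a (g k) = complex_of_real (lam k)"
    using bij_betw_of_card_fibers[OF fin card] by blast
  have a_real: "a k = complex_of_real (Re (a k))" if k: "k \<in> K'" for k
  proof -
    obtain l where "l \<in> K" "k = g l" using g(1) k unfolding bij_betw_def by blast
    then show ?thesis using g(2) by simp
  qed
  \<comment> \<open>Every value of the Hadamard enumeration is one of the real numbers \<open>lam l\<close>, so the reciprocals
    can be taken in the reals.\<close>
  define v where "v k = (if k \<in> K' \<and> a k \<noteq> 0 then 1 / Re (a k) else 0)" for k
  have v: "complex_of_real (v k) = 1 / a k" if "k \<in> K'" "a k \<noteq> 0" for k
    using that a_real[of k] by (simp add: v_def)
  have f': "f z = z ^ n * exp (poly Q z) * (\<Prod>k. weierstrass_factor q (z * v k))" for z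
  proof -
    have "(if k \<in> K' \<and> a k \<noteq> 0 then weierstrass_factor q (z / a k) else 1) =
            weierstrass_factor q (z * v k)" for k
      using v[of k] by (auto simp: v_def)
    then show ?thesis unfolding f n_def by simp
  qed
  have sum: "summable (\<lambda>k. \<bar>v k\<bar> ^ (q + 1))"
  proof -
    have "(\<lambda>k. \<bar>v k\<bar> ^ (q + 1)) summable_on UNIV \<longleftrightarrow>
            (\<lambda>k. 1 / norm (a k) ^ (q + 1)) summable_on {k\<in>K'. a k \<noteq> 0}"
    proof (rule summable_on_cong_neutral)
      fix k assume "k \<in> UNIV \<inter> {k\<in>K'. a k \<noteq> 0}"
      then have "norm (complex_of_real (v k)) = norm (1 / a k)"
        by (intro arg_cong[of _ _ norm] v) simp_all
      then have "\<bar>v k\<bar> = 1 / norm (a k)" by (simp add: norm_divide)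
      then show "\<bar>v k\<bar> ^ (q + 1) = 1 / norm (a k) ^ (q + 1)" by (simp add: power_divide)
    qed (auto simp: v_def)
    then show ?thesis using summable_on summable_on_imp_summable by blast
  qed
  have m: "degree Q div 2 \<le> m" "q div 2 \<le> m"
    using p assms(5) by (auto intro: div_le_mono)
  have diff: "((deriv ^^ j) u) differentiable (at x)" if "x > 0" for j x
    using that by (intro iterated_deriv_ln_norm_imaginary_axis(1)[OF assms(1) f' sum assms(4)])
  have nonzero_part: "(\<lambda>k. ((v k)\<^sup>2 / (1 + (v k)\<^sup>2 * x)) ^ (m + 1)) sums
      (2 * (-1) ^ m * (deriv ^^ (m + 1)) u x / fact m - n * (1 / x) ^ (m + 1))" if "x > 0" for x
    using that m by (intro iterated_deriv_ln_norm_imaginary_axis(2)[OF assms(1) f' sum assms(4)])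
  have main: "integrable \<mu> (\<lambda>t. 1 / (t + x) ^ (m + 1)) \<and>
      (-1) ^ m * (deriv ^^ (m + 1)) u x = fact m / 2 * (\<integral>t. 1 / (t + x) ^ (m + 1) \<partial>\<mu>)"
    if x: "x > 0" for x
  proof -
    \<comment> \<open>The value that the integral must have; the zeros at the origin and the nonzero zeros are now
      put together into one series over the Hadamard enumeration.\<close>
    define s where "s = 2 * (-1) ^ m * (deriv ^^ (m + 1)) u x / fact m"
    have "(\<lambda>k. (if k \<in> {k\<in>K'. a k = 0} then (1 / x) ^ (m + 1) else 0) +
               ((v k)\<^sup>2 / (1 + (v k)\<^sup>2 * x)) ^ (m + 1)) sums
            (n * (1 / x) ^ (m + 1) + (s - n * (1 / x) ^ (m + 1)))"
      using sums_If_finite_set[OF fin0, of "\<lambda>_. (1 / x) ^ (m + 1)"] nonzero_part[OF x]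
      by (intro sums_add) (simp_all add: n_def s_def)
    also have "(\<lambda>k. (if k \<in> {k\<in>K'. a k = 0} then (1 / x) ^ (m + 1) else 0) +
               ((v k)\<^sup>2 / (1 + (v k)\<^sup>2 * x)) ^ (m + 1)) =
             (\<lambda>k. if k \<in> K' then 1 / ((Re (a k))\<^sup>2 + x) ^ (m + 1) else 0)"
    proof
      fix k
      have "(v k)\<^sup>2 / (1 + (v k)\<^sup>2 * x) = 1 / ((Re (a k))\<^sup>2 + x)" if "k \<in> K'" "a k \<noteq> 0"
      proof -
        have "Re (a k) \<noteq> 0" using that a_real[of k] by auto
        then have "(Re (a k))\<^sup>2 > 0" by simp
        then show ?thesis using that x by (simp add: v_def power_divide field_simps)
      qed
      then show "(if k \<in> {k\<in>K'. a k = 0} then (1 / x) ^ (m + 1) else 0) +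
               ((v k)\<^sup>2 / (1 + (v k)\<^sup>2 * x)) ^ (m + 1) =
             (if k \<in> K' then 1 / ((Re (a k))\<^sup>2 + x) ^ (m + 1) else 0)"
        by (cases "k \<in> K' \<and> a k \<noteq> 0") (auto simp: v_def power_one_over simp del: power_Suc)
    qed
    finally have sums: "(\<lambda>k. if k \<in> K' then 1 / ((Re (a k))\<^sup>2 + x) ^ (m + 1) else 0) sums s"
      by simp
    have nonneg: "1 / ((Re (a k))\<^sup>2 + x) ^ (m + 1) \<ge> 0" for k using x by simp
    note count = integral_count_space_nat_subset[OF sums nonneg]
    \<comment> \<open>Transport to the given enumeration.\<close>
    have cong: "1 / ((lam k)\<^sup>2 + x) ^ (m + 1) = 1 / ((Re (a (g k)))\<^sup>2 + x) ^ (m + 1)"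
      if "k \<in> space (count_space K)" for k
      using that g(2)[of k] by simp
    have "integrable \<mu> (\<lambda>t. 1 / (t + x) ^ (m + 1))"
      unfolding assms(6)
      by (subst integrable_point_mass_sum, simp,
          subst Bochner_Integration.integrable_cong[OF refl cong], assumption,
          subst integrable_bij_count_space[OF g(1)]) (rule count(1))
    moreover have "(\<integral>t. 1 / (t + x) ^ (m + 1) \<partial>\<mu>) = s"
      unfolding assms(6)
      by (subst integral_point_mass_sum, simp,
          subst Bochner_Integration.integral_cong[OF refl cong], assumption,
          subst integral_bij_count_space[OF g(1)]) (rule count(2))
    ultimately show ?thesis by (simp add: s_def)
  qed
  have "generalised_stieltjes (real (m + 1)) (\<lambda>x. (-1) ^ m * (deriv ^^ (m + 1)) u x)"
    by (rule generalised_stieltjesI[where \<mu> = \<mu> and c = "fact m / 2"])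
       (use main in \<open>auto simp: assms(6) point_mass_sum_def\<close>)
  with main diff show ?thesis by blast
qed

end
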